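(* Misère Connect $k$, $k\ge 2$, played on a board of infinite width (with any height) is a draw under optimal play: each player has a strategy guaranteeing that they never connect $k$.
   Context: Misère Connect $k$ is played on a grid with $w$ columns and $h$ rows; here there are infinitely many columns (arranged in a line), and the height $h\ge 1$ may be finite or infinite. Player 1 (P1) and Player 2 (P2) alternate turns, P1 first. On each turn the player selects a non-full column and their piece occupies the lowest empty cell of that column; a column of finite height $h$ is full after $h$ plays. A player connects $k$ when $k$ of their pieces occupy $k$ consecutive cells in a horizontal, vertical, or diagonal (either direction) line. The first player to connect $k$ loses. A play that continues forever with no player connecting $k$ is a draw. *)

theory Defs
  imports Complex_Main "HOL-Library.Extended_Nat"
begin

text \<open>The columns of a board of infinite width are an infinite set of consecutive integers: either
  all of \<open>\<int>\<close> or a half-line.  Both readings of ``infinitely many columns in a line'' are covered.\<close>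

definition infinite_line :: "int set \<Rightarrow> bool" where
  "infinite_line C \<longleftrightarrow> infinite C \<and> (\<forall>a\<in>C. \<forall>b\<in>C. {a..b} \<subseteq> C)"

datatype player = P1 | P2

text \<open>A position is the chronological list of the columns played so far.\<close>

type_synonym position = "int list"

definition turn :: "nat \<Rightarrow> player" where
  "turn n = (if even n then P1 else P2)"

definition cell_of :: "position \<Rightarrow> nat \<Rightarrow> int \<times> int" where
  "cell_of ms i = (ms ! i, int (count_list (take i ms) (ms ! i)))"

definition pieces :: "player \<Rightarrow> position \<Rightarrow> (int \<times> int) set" where
  "pieces p ms = {cell_of ms i | i. i < length ms \<and> turn i = p}"

definition connects :: "nat \<Rightarrow> player \<Rightarrow> position \<Rightarrow> bool" where
  "connects k p ms \<longleftrightarrow>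
     (\<exists>x y. \<exists>(dx, dy) \<in> {(1, 0), (0, 1), (1, 1), (1, -1)}.
        \<forall>i<k. (x + int i * dx, y + int i * dy) \<in> pieces p ms)"

definition game_over :: "nat \<Rightarrow> position \<Rightarrow> bool" where
  "game_over k ms \<longleftrightarrow> (\<exists>p. connects k p ms)"

definition legal_move :: "int set \<Rightarrow> enat \<Rightarrow> position \<Rightarrow> int \<Rightarrow> bool" where
  "legal_move C h ms c \<longleftrightarrow> c \<in> C \<and> enat (count_list ms c) < h"

definition legal_position :: "int set \<Rightarrow> enat \<Rightarrow> nat \<Rightarrow> position \<Rightarrow> bool" where
  "legal_position C h k ms \<longleftrightarrow>
     (\<forall>i<length ms. \<not> game_over k (take i ms) \<and> legal_move C h (take i ms) (ms ! i))"

text \<open>There is no outcome ``board full'': with infinitely many columns of height at least 1 a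
  legal move always exists, so a play stops only when somebody connects \<open>k\<close>.\<close>

datatype play = Finished position | Endless "nat \<Rightarrow> int"

fun stages :: "play \<Rightarrow> position set" where
  "stages (Finished ms) = {take n ms | n. n \<le> length ms}"
| "stages (Endless f) = {map f [0..<n] | n. True}"

fun complete_play :: "int set \<Rightarrow> enat \<Rightarrow> nat \<Rightarrow> play \<Rightarrow> bool" where
  "complete_play C h k (Finished ms) \<longleftrightarrow> legal_position C h k ms \<and> game_over k ms"
| "complete_play C h k (Endless f) \<longleftrightarrow> (\<forall>n. legal_position C h k (map f [0..<n]))"

text \<open>Before the last move of a finished play nobody has connected \<open>k\<close>, and a move adds a piece of
  the mover only, so exactly one player connects \<open>k\<close> in its final position.\<close>

fun loses :: "nat \<Rightarrow> player \<Rightarrow> play \<Rightarrow> bool" where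
  "loses k p (Finished ms) \<longleftrightarrow> connects k p ms"
| "loses k p (Endless f) \<longleftrightarrow> False"

type_synonym strategy = "position \<Rightarrow> int"

definition valid_strategy :: "int set \<Rightarrow> enat \<Rightarrow> nat \<Rightarrow> player \<Rightarrow> strategy \<Rightarrow> bool" where
  "valid_strategy C h k p s \<longleftrightarrow>
     (\<forall>ms. legal_position C h k ms \<and> \<not> game_over k ms \<and> turn (length ms) = p
        \<longrightarrow> legal_move C h ms (s ms))"

definition follows :: "player \<Rightarrow> strategy \<Rightarrow> play \<Rightarrow> bool" where
  "follows p s \<pi> \<longleftrightarrow>
     (\<forall>ms\<in>stages \<pi>. \<forall>i<length ms. turn i = p \<longrightarrow> ms ! i = s (take i ms))"

definition non_losing_strategy :: "int set \<Rightarrow> enat \<Rightarrow> nat \<Rightarrow> player \<Rightarrow> strategy \<Rightarrow> bool" where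
  "non_losing_strategy C h k p s \<longleftrightarrow> valid_strategy C h k p s \<and>
     (\<forall>\<pi>. complete_play C h k \<pi> \<and> follows p s \<pi> \<longrightarrow> \<not> loses k p \<pi>)"

definition never_connecting_strategy :: "int set \<Rightarrow> enat \<Rightarrow> nat \<Rightarrow> player \<Rightarrow> strategy \<Rightarrow> bool" where
  "never_connecting_strategy C h k p s \<longleftrightarrow> valid_strategy C h k p s \<and>
     (\<forall>\<pi>. complete_play C h k \<pi> \<and> follows p s \<pi> \<longrightarrow> (\<forall>ms\<in>stages \<pi>. \<not> connects k p ms))"

definition draw_under_optimal_play :: "int set \<Rightarrow> enat \<Rightarrow> nat \<Rightarrow> bool" where
  "draw_under_optimal_play C h k \<longleftrightarrow> (\<forall>p. \<exists>s. non_losing_strategy C h k p s)"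

end

theory Submission
  imports Defs
begin

text \<open>Since the board has infinitely many columns, a player can always drop a piece into a column
  that is at distance at least 2 from every column used so far, by either player
  (\<open>isolated_column\<close>).  Any two pieces of a player who does this from the start lie
  in columns at distance at least 2, whatever the opponent does, whereas a line of
  \<open>k \<ge> 2\<close> pieces contains two neighbouring cells, whose columns differ by at most 1
  (\<open>isolating_not_connects\<close>).  Such a column is empty, so playing it is legal for every
  height \<open>h \<ge> 1\<close>.  The same strategy therefore serves both players and all \<open>k \<ge> 2\<close>.\<close>

definition isolated_from :: "position \<Rightarrow> int \<Rightarrow> bool" where
  "isolated_from ms c \<longleftrightarrow> (\<forall>m\<in>set ms. 2 \<le> \<bar>c - m\<bar>)"

definition isolating_strategy :: "int set \<Rightarrow> strategy" where
  "isolating_strategy C ms = (SOME c. c \<in> C \<and> isolated_from ms c)"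

text \<open>Each past move rules out only three columns.\<close>

lemma isolated_column:
  assumes "infinite C"
  shows "\<exists>c\<in>C. isolated_from ms c"
proof -
  have "finite (\<Union>m\<in>set ms. {m - 1..m + 1})"
    by simp
  then obtain c where "c \<in> C" and "c \<notin> (\<Union>m\<in>set ms. {m - 1..m + 1})"
    using assms by (meson finite_subset subsetI)
  then show ?thesis
    unfolding isolated_from_def by (intro bexI[of _ c]) force+
qed

lemma isolating_strategy:
  assumes "infinite C"
  shows "isolating_strategy C ms \<in> C" and "isolated_from ms (isolating_strategy C ms)"
  using someI_ex[of "\<lambda>c. c \<in> C \<and> isolated_from ms c"] isolated_column[OF assms, of ms]
  unfolding isolating_strategy_def by blast+

lemma isolating_strategy_valid:
  assumes "infinite C" and "h \<ge> 1"
  shows "valid_strategy C h k p (isolating_strategy C)"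
proof -
  have "enat (count_list ms (isolating_strategy C ms)) < h" for ms
  proof -
    have "isolating_strategy C ms \<notin> set ms"
      using isolating_strategy(2)[OF assms(1), of ms] by (auto simp: isolated_from_def)
    then have "count_list ms (isolating_strategy C ms) = 0"
      by (simp add: count_list_0_iff)
    with assms(2) show ?thesis
      by (cases h) (simp_all add: one_enat_def)
  qed
  with isolating_strategy(1)[OF assms(1)] show ?thesis
    unfolding valid_strategy_def legal_move_def by blast
qed

text \<open>Only the player's own moves are constrained: isolation of the later of two pieces already
  separates it from the earlier one.\<close>

lemma isolating_not_connects:
  assumes iso: "\<And>i. i < length ms \<Longrightarrow> turn i = p \<Longrightarrow> isolated_from (take i ms) (ms ! i)"
    and "k \<ge> 2"
  shows "\<not> connects k p ms"
proof
  assume "connects k p ms"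
  then obtain x y dx dy where d: "(dx, dy) \<in> {(1, 0), (0, 1), (1, 1), (1, - 1::int)}"
    and line: "\<And>i. i < k \<Longrightarrow> (x + int i * dx, y + int i * dy) \<in> pieces p ms"
    unfolding connects_def by blast
  from line[of 0] \<open>k \<ge> 2\<close> obtain i where i: "i < length ms" "turn i = p" "cell_of ms i = (x, y)"
    unfolding pieces_def by auto
  from line[of 1] \<open>k \<ge> 2\<close> obtain j
    where j: "j < length ms" "turn j = p" "cell_of ms j = (x + dx, y + dy)"
    unfolding pieces_def by auto
  have sep: "2 \<le> \<bar>ms ! b - ms ! a\<bar>" if "a < b" "b < length ms" "turn b = p" for a b
  proof -
    have "ms ! a \<in> set (take b ms)"
      using that by (auto simp: in_set_conv_nth intro!: exI[of _ a])
    with iso[OF that(2,3)] show ?thesis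
      by (simp add: isolated_from_def)
  qed
  have "\<bar>ms ! j - ms ! i\<bar> \<le> 1"
    using d i(3) j(3) by (auto simp: cell_of_def)
  then have "i = j"
    using sep[of i j] sep[of j i] i j by (cases i j rule: linorder_cases) auto
  with d i(3) j(3) show False
    by auto
qed

lemma isolating_strategy_never_connecting:
  assumes "infinite C" and "h \<ge> 1" and "k \<ge> 2"
  shows "never_connecting_strategy C h k p (isolating_strategy C)"
proof -
  have "\<not> connects k p ms" if "follows p (isolating_strategy C) \<pi>" "ms \<in> stages \<pi>" for \<pi> ms
    using that isolating_strategy(2)[OF assms(1)] assms(3)
    by (intro isolating_not_connects) (simp_all add: follows_def)
  with isolating_strategy_valid[OF assms(1,2)] show ?thesis
    unfolding never_connecting_strategy_def by blast
qed

lemma never_connecting_imp_non_losing: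
  assumes "never_connecting_strategy C h k p s"
  shows "non_losing_strategy C h k p s"
proof -
  have "\<exists>ms\<in>stages \<pi>. connects k p ms" if "loses k p \<pi>" for \<pi>
    using that by (cases \<pi>) auto
  with assms show ?thesis
    unfolding never_connecting_strategy_def non_losing_strategy_def by blast
qed

theorem mainTheorem7:
  fixes C :: "int set" and h :: enat and k :: nat
  assumes "infinite_line C" and "h \<ge> 1" and "k \<ge> 2"
  shows "draw_under_optimal_play C h k \<and>
         (\<forall>p. \<exists>s. never_connecting_strategy C h k p s)"
proof -
  have "infinite C"
    using assms(1) by (simp add: infinite_line_def)
  then have "never_connecting_strategy C h k p (isolating_strategy C)" for p
    using assms(2,3) by (rule isolating_strategy_never_connecting)
  then show ?thesis
    unfolding draw_under_optimal_play_def using never_connecting_imp_non_losing by blast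
qed

end
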